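(* Let $\mathbf{D}=[\mathbf{d}_0|\dots|\mathbf{d}_{P-1}]\in\mathbb{C}^{L\times P}$ be a dictionary with normalized atoms, $\|\mathbf{d}_p\|_2=1$ for all $p$, and let $\mathbf{x}\in\mathbb{R}^L$ be a signal. Fix $\epsilon>0$ and $0<\delta<1/2$. Let $\mathbf{G}_\epsilon$ be the Gram matrix of $\mathbf{D}$ hard-thresholded at $\epsilon$, and let the indices $p_{k+1}$, the coefficient-domain residuals $\boldsymbol{\varrho}_k$, the coefficient vectors $\mathbf{c}_k$ and the true residuals $\mathbf{r}_k=\mathbf{x}-\mathbf{D}\mathbf{c}_k$, $k\ge 0$, be generated by approximate coefficient-domain matching pursuit with $\mathbf{G}_\epsilon$ (as defined in the context). If, for some $k\ge 0$, $$|\boldsymbol{\varrho}_k(p_{k+1})|\ \ge\ \frac{\epsilon}{\delta}\sum_{l=1}^{k}|\boldsymbol{\varrho}_{l-1}(p_l)|\qquad\text{and}\qquad |\boldsymbol{\varrho}_k(p_{k+1})|\ >\ \frac{2\delta}{1-2\delta}\,\|\mathbf{r}_k\|_2,$$ then $\|\mathbf{r}_{k+1}\|_2^2<\|\mathbf{r}_k\|_2^2$.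
   Context: The inner product on $\mathbb{C}^L$ is $\langle \mathbf{x},\mathbf{y}\rangle=\mathbf{y}^*\mathbf{x}=\sum_l \mathbf{x}(l)\overline{\mathbf{y}(l)}$ and $\|\cdot\|_2$ is the induced norm; real vectors are regarded as elements of $\mathbb{C}^L$. The Gram matrix is $\mathbf{G}=\mathbf{D}^*\mathbf{D}\in\mathbb{C}^{P\times P}$, i.e. $\mathbf{G}(k,j)=\langle\mathbf{d}_j,\mathbf{d}_k\rangle$. The hard-thresholded Gram matrix $\mathbf{G}_\epsilon$ is given by $\mathbf{G}_\epsilon(k,j)=\mathbf{G}(k,j)$ if $|\mathbf{G}(k,j)|>\epsilon$ and $\mathbf{G}_\epsilon(k,j)=0$ otherwise. $\mathbf{G}_\epsilon(\bullet,p)$ denotes the $p$-th column, and $\mathbf{e}_p\in\mathbb{C}^P$ the $p$-th standard unit vector. Approximate coefficient-domain matching pursuit with $\mathbf{G}_\epsilon$: set $\mathbf{c}_0=\mathbf{0}\in\mathbb{C}^P$, $\boldsymbol{\varrho}_0=\mathbf{D}^*\mathbf{x}$, and for $k\ge 0$ $$p_{k+1}=\operatorname{argmax}_p|\boldsymbol{\varrho}_k(p)|,\quad \boldsymbol{\varrho}_{k+1}=\boldsymbol{\varrho}_k-\boldsymbol{\varrho}_k(p_{k+1})\,\mathbf{G}_\epsilon(\bullet,p_{k+1}),\quad \mathbf{c}_{k+1}=\mathbf{c}_k+\boldsymbol{\varrho}_k(p_{k+1})\,\mathbf{e}_{p_{k+1}},$$ where $p_{k+1}$ is any maximizing index. The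 true residual is $\mathbf{r}_k=\mathbf{x}-\mathbf{D}\mathbf{c}_k$. Empty sums are zero. *)

theory Defs
  imports "HOL-Analysis.Analysis"
begin

text \<open>
  Vectors in \<open>\<complex>\<^sup>L\<close> and \<open>\<complex>\<^sup>P\<close> are \<open>complex ^ 'l\<close> and \<open>complex ^ 'p\<close>, with \<open>norm\<close> the Euclidean norm.
  The library inner product \<open>\<bullet>\<close> on these types is real-valued, hence the separate \<open>cinner\<close>.
\<close>

definition cinner :: "complex ^ 'l \<Rightarrow> complex ^ 'l \<Rightarrow> complex"
  where "cinner x y = (\<Sum>l\<in>UNIV. x $ l * cnj (y $ l))"

definition conj_transpose :: "complex ^ 'p ^ 'l \<Rightarrow> complex ^ 'l ^ 'p"
  where "conj_transpose A = (\<chi> p l. cnj (A $ l $ p))"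

definition complex_vec :: "real ^ 'l \<Rightarrow> complex ^ 'l"
  where "complex_vec x = (\<chi> l. complex_of_real (x $ l))"

definition gram :: "complex ^ 'p ^ 'l \<Rightarrow> complex ^ 'p ^ 'p"
  where "gram D = conj_transpose D ** D"

definition hard_threshold :: "real \<Rightarrow> complex ^ 'n ^ 'm \<Rightarrow> complex ^ 'n ^ 'm"
  where "hard_threshold \<epsilon> A = (\<chi> k j. if norm (A $ k $ j) > \<epsilon> then A $ k $ j else 0)"

lemma norm_eq_cinner: "complex_of_real ((norm x)\<^sup>2) = cinner x x"
  by (simp add: cinner_def norm_vec_def L2_set_def sum_nonneg flip: complex_norm_square)

lemma gram_nth: "gram D $ k $ j = cinner (column j D) (column k D)"
  by (simp add: gram_def conj_transpose_def matrix_matrix_mult_def cinner_def column_def mult.commute)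

lemma conj_transpose_mult_nth: "(conj_transpose D *v x) $ p = cinner x (column p D)"
  by (simp add: conj_transpose_def matrix_vector_mult_def cinner_def column_def mult.commute)

text \<open>
  \<open>coeff_mp H D x p \<rho> c\<close>: the sequences \<open>p\<close>, \<open>\<rho>\<close>, \<open>c\<close> are a possible run of coefficient-domain
  matching pursuit on \<open>x\<close> that uses \<open>H\<close> in place of the Gram matrix of \<open>D\<close>. It is a relation because
  ties in the index selection may be broken arbitrarily; the value \<open>p 0\<close> is irrelevant.
\<close>

definition coeff_mp ::
    "complex ^ 'p ^ 'p \<Rightarrow> complex ^ 'p ^ 'l \<Rightarrow> complex ^ 'l \<Rightarrow>
     (nat \<Rightarrow> 'p) \<Rightarrow> (nat \<Rightarrow> complex ^ 'p) \<Rightarrow> (nat \<Rightarrow> complex ^ 'p) \<Rightarrow> bool"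
  where "coeff_mp H D x p \<rho> c \<longleftrightarrow>
    c 0 = 0 \<and> \<rho> 0 = conj_transpose D *v x \<and>
    (\<forall>k. is_arg_max (\<lambda>q. norm (\<rho> k $ q)) (\<lambda>q. True) (p (Suc k)) \<and>
         \<rho> (Suc k) = \<rho> k - (\<rho> k $ p (Suc k)) *s column (p (Suc k)) H \<and>
         c (Suc k) = c k + (\<rho> k $ p (Suc k)) *s axis (p (Suc k)) 1)"

definition true_residual ::
    "complex ^ 'p ^ 'l \<Rightarrow> complex ^ 'l \<Rightarrow> (nat \<Rightarrow> complex ^ 'p) \<Rightarrow> nat \<Rightarrow> complex ^ 'l"
  where "true_residual D x c k = x - D *v c k"

end

theory Submission
  imports Defs
begin

text \<open>
  Write \<open>a = \<rho> k $ p (k + 1)\<close> for the coefficient that the algorithm uses, \<open>d\<close> for the selected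
  atom, and \<open>b = cinner (r k) d\<close> for the coefficient that exact matching pursuit would use.
  Subtracting \<open>b *s d\<close> removes the component of \<open>r k\<close> along \<open>d\<close>; subtracting \<open>a *s d\<close> instead leaves
  the extra component \<open>(b - a) *s d\<close>, which is orthogonal to the remainder. By Pythagoras
  (\<open>norm_diff_unit_multiple\<close>) the squared residual norm therefore changes by
  \<open>(cmod (a - b))\<^sup>2 - (cmod b)\<^sup>2\<close>, and it decreases exactly if \<open>cmod (a - b) < cmod b\<close>.

  With the exact Gram matrix, \<open>\<rho>\<close> would always hold the inner products of the true residual with the
  atoms. Thresholding perturbs each entry of the Gram matrix by at most \<open>\<epsilon>\<close>, so each step moves each
  entry of \<open>\<rho>\<close> away from the true inner product by at most \<open>\<epsilon>\<close> times the coefficient used in that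
  step (\<open>coefficient_residual_error\<close>). The first condition on the run bounds the accumulated error
  by \<open>\<delta> * cmod a\<close>. Since \<open>\<delta> < 1 / 2\<close>, the triangle inequality then gives
  \<open>cmod (a - b) \<le> \<delta> * cmod a < (1 - \<delta>) * cmod a \<le> cmod b\<close>, where \<open>a \<noteq> 0\<close> by the second condition.
\<close>

lemma cinner_diff_left: "cinner (x - y) z = cinner x z - cinner y z"
  by (simp add: cinner_def left_diff_distrib sum_subtractf)

lemma cinner_scale_left: "cinner (a *s x) z = a * cinner x z"
  by (simp add: cinner_def sum_distrib_left mult.assoc)

lemma cinner_diff_right: "cinner z (x - y) = cinner z x - cinner z y"
  by (simp add: cinner_def right_diff_distrib sum_subtractf)

lemma cinner_scale_right: "cinner z (a *s x) = cnj a * cinner z x"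
  by (simp add: cinner_def sum_distrib_left mult.left_commute)

lemma cnj_cinner: "cnj (cinner x y) = cinner y x"
  by (simp add: cinner_def mult.commute)

text \<open>
  Only the component of \<open>x\<close> along the unit vector \<open>d\<close> changes, from \<open>cinner x d\<close> to
  \<open>cinner x d - a\<close>; the orthogonal component, with squared norm
  \<open>(norm x)\<^sup>2 - (cmod (cinner x d))\<^sup>2\<close>, stays.
\<close>

lemma norm_diff_unit_multiple:
  fixes x d :: "complex ^ 'l"
  assumes "norm d = 1"
  shows "(norm (x - a *s d))\<^sup>2
    = (norm x)\<^sup>2 - (norm (cinner x d))\<^sup>2 + (norm (a - cinner x d))\<^sup>2"
proof -
  have dd: "cinner d d = 1"
    using norm_eq_cinner[of d] assms by simp
  have dx: "cinner d x = cnj (cinner x d)"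
    by (simp add: cnj_cinner)
  have "complex_of_real ((norm (x - a *s d))\<^sup>2)
    = cinner x x - cnj a * cinner x d - a * cinner d x + a * cnj a"
    unfolding norm_eq_cinner
    by (simp add: cinner_diff_left cinner_diff_right
        cinner_scale_left cinner_scale_right dd algebra_simps)
  also have "\<dots> = cinner x x - cinner x d * cnj (cinner x d)
      + (a - cinner x d) * cnj (a - cinner x d)"
    by (simp add: dx algebra_simps)
  also have "\<dots> = complex_of_real
      ((norm x)\<^sup>2 - (norm (cinner x d))\<^sup>2 + (norm (a - cinner x d))\<^sup>2)"
    by (simp only: of_real_add of_real_diff norm_eq_cinner complex_norm_square)
  finally show ?thesis
    by (simp only: of_real_eq_iff)
qed

lemma hard_threshold_error:
  assumes "0 \<le> \<epsilon>"
  shows "norm (hard_threshold \<epsilon> A $ i $ j - A $ i $ j) \<le> \<epsilon>"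
  using assms by (simp add: hard_threshold_def)

lemma matrix_vector_mult_axis: "D *v axis j 1 = column j D"
  for D :: "complex ^ 'p ^ 'l"
  by (simp add: vec_eq_iff matrix_vector_mult_def column_def axis_def if_distrib cong: if_cong)

lemma true_residual_Suc:
  assumes "coeff_mp H D x p \<rho> c"
  shows "true_residual D x c (Suc k)
    = true_residual D x c k - (\<rho> k $ p (Suc k)) *s column (p (Suc k)) D"
  using assms
  by (simp add: coeff_mp_def true_residual_def matrix_vector_right_distrib
      vector_scalar_commute matrix_vector_mult_axis)

text \<open>
  If \<open>H\<close> were \<open>gram D\<close>, then \<open>\<rho> k $ q\<close> would equal \<open>cinner (true_residual D x c k) (column q D)\<close>,
  because both start as the correlation of \<open>x\<close> with the atom \<open>q\<close> and obey the same recursion.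
  In general, the recursions differ in step \<open>l\<close> by the coefficient \<open>\<rho> (l - 1) $ p l\<close> times an entry
  of \<open>gram D - H\<close>, and these differences add up.
\<close>

lemma coefficient_residual_error:
  assumes run: "coeff_mp H D x p \<rho> c"
    and H: "\<And>i j. norm (H $ i $ j - gram D $ i $ j) \<le> \<epsilon>"
  shows "norm (\<rho> k $ q - cinner (true_residual D x c k) (column q D))
    \<le> \<epsilon> * (\<Sum>l=1..k. norm (\<rho> (l - 1) $ p l))"
proof (induction k)
  case 0
  show ?case
    using run by (simp add: coeff_mp_def true_residual_def conj_transpose_mult_nth)
next
  case (Suc k)
  let ?j = "p (Suc k)"
  let ?a = "\<rho> k $ ?j"
  let ?e = "\<lambda>k. \<rho> k $ q - cinner (true_residual D x c k) (column q D)"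
  have "\<rho> (Suc k) = \<rho> k - ?a *s column ?j H"
    using run by (simp add: coeff_mp_def)
  then have "\<rho> (Suc k) $ q = \<rho> k $ q - ?a * H $ q $ ?j"
    by (simp add: column_def)
  then have "?e (Suc k) = ?e k - ?a * (H $ q $ ?j - gram D $ q $ ?j)"
    by (simp add: true_residual_Suc[OF run] cinner_diff_left cinner_scale_left
        gram_nth algebra_simps)
  then have "norm (?e (Suc k)) \<le> norm (?e k) + norm (?a * (H $ q $ ?j - gram D $ q $ ?j))"
    by (simp add: norm_triangle_ineq4)
  also have "\<dots> \<le> norm (?e k) + norm ?a * \<epsilon>"
    using H by (simp add: norm_mult mult_left_mono)
  also have "\<dots> \<le> \<epsilon> * (\<Sum>l=1..Suc k. norm (\<rho> (l - 1) $ p l))"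
    using Suc.IH by (simp add: algebra_simps)
  finally show ?case .
qed

text \<open>
  Any relative error below one half in the coefficient still reduces the residual: then
  \<open>cinner x d\<close> is closer to \<open>a\<close> than to \<open>0\<close>.
\<close>

lemma norm_diff_unit_multiple_less:
  fixes x d :: "complex ^ 'l"
  assumes "norm d = 1" and "a \<noteq> 0" and "\<delta> < 1 / 2"
    and "norm (a - cinner x d) \<le> \<delta> * norm a"
  shows "(norm (x - a *s d))\<^sup>2 < (norm x)\<^sup>2"
proof -
  have "\<delta> * norm a < (1 / 2) * norm a"
    using assms by (intro mult_strict_right_mono) auto
  moreover have "norm a \<le> norm (a - cinner x d) + norm (cinner x d)"
    using norm_triangle_ineq[of "a - cinner x d" "cinner x d"] by simp
  ultimately have "norm (a - cinner x d) < norm (cinner x d)"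
    using assms(4) by linarith
  then have "(norm (a - cinner x d))\<^sup>2 < (norm (cinner x d))\<^sup>2"
    by (simp add: power_strict_mono)
  then show ?thesis
    by (simp add: norm_diff_unit_multiple[OF assms(1)])
qed

theorem theorem1:
  fixes D :: "complex ^ 'p ^ 'l" and x :: "real ^ 'l"
    and \<epsilon> \<delta> :: real
    and p :: "nat \<Rightarrow> 'p" and \<rho> c :: "nat \<Rightarrow> complex ^ 'p"
    and r :: "nat \<Rightarrow> complex ^ 'l" and k :: nat
  assumes normalized: "\<And>q. norm (column q D) = 1"
    and eps: "\<epsilon> > 0"
    and delta: "0 < \<delta>" "\<delta> < 1 / 2"
    and run: "coeff_mp (hard_threshold \<epsilon> (gram D)) D (complex_vec x) p \<rho> c"
    and residual: "r = true_residual D (complex_vec x) c"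
    and cond1: "norm (\<rho> k $ p (k + 1)) \<ge> \<epsilon> / \<delta> * (\<Sum>l=1..k. norm (\<rho> (l - 1) $ p l))"
    and cond2: "norm (\<rho> k $ p (k + 1)) > 2 * \<delta> / (1 - 2 * \<delta>) * norm (r k)"
  shows "(norm (r (k + 1)))\<^sup>2 < (norm (r k))\<^sup>2"
proof -
  let ?a = "\<rho> k $ p (Suc k)"
  let ?d = "column (p (Suc k)) D"
  have "0 \<le> 2 * \<delta> / (1 - 2 * \<delta>) * norm (r k)"
    using delta by simp
  then have "0 < norm ?a"
    using cond2 unfolding Suc_eq_plus1 by (rule le_less_trans)
  then have a: "?a \<noteq> 0"
    by simp
  have "norm (?a - cinner (r k) ?d) \<le> \<epsilon> * (\<Sum>l=1..k. norm (\<rho> (l - 1) $ p l))"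
    unfolding residual
    by (rule coefficient_residual_error[OF run]) (simp add: hard_threshold_error eps less_imp_le)
  also have "\<dots> \<le> \<delta> * norm ?a"
    using cond1 delta(1) by (simp add: field_simps)
  finally have "(norm (r k - ?a *s ?d))\<^sup>2 < (norm (r k))\<^sup>2"
    using norm_diff_unit_multiple_less[OF normalized a delta(2)] by blast
  then show ?thesis
    by (simp add: residual true_residual_Suc[OF run])
qed

end
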